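(* Let $L$ be an intermediate logic with the disjunction property, let $\mathcal{R}$ be a set of m-rules, and let $q$ be a propositional variable not occurring in any rule of $\mathcal{R}$. Suppose that $\mathcal{R}^q=\{r^q: r\in\mathcal{R}\}$ consists of rules admissible for $L$ and is an independent s-basis for $L$. Then $\mathcal{R}^q\cup\{\mathsf{DP}\}$ is an independent m-basis for $L$, where $\mathsf{DP}$ is the m-rule $p\lor q'/p,q'$ (with $p,q'$ distinct variables).
   Context: Formulas are built from a countable set of propositional variables using $\land,\lor,\to,\neg,\bot,\top$; empty conjunction is $\top$, empty disjunction is $\bot$. For an m-rule $r=\Gamma/\Delta$, $r^q$ is the rule $\bigwedge_{A\in\Gamma}A\lor q\,/\,\bigvee_{B\in\Delta}B\lor q$. An intermediate logic is a set $L$ of formulas with $\mathrm{Int}\subseteq L\subsetneq$ (all formulas), closed under modus ponens and substitution; it has the disjunction property if $A\lor B\in L$ implies $A\in L$ or $B\in L$. An m-rule is a pair of finite sets of formulas $\Gamma/\Delta$; a rule has one conclusion. An m-rule is admissible for $L$ if for every substitution $\sigma$, $\sigma(\Gamma)\subseteq L$ implies $\sigma(\Delta)\cap L\ne\emptyset$. An m-consequence is a relation $\vdash$ between finite sets of formulas satisfying reflexivity $A\vdash A$, monotonicity, cut (if $\Gamma,A\vdash\Delta$ and $\Gamma'\vdash A,\Delta'$ then $\Gamma\cup\Gamma'\vdash\Delta\cup\Delta'$) and closure under substitutions. For a set $\mathcal{S}$ of m-rules, $\vdash_\mathcal{S}$ is the least m-consequence containing intuitionistic derivability with $\Gamma\vdash_\mathcal{S}\Delta$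 for all $\Gamma/\Delta\in\mathcal{S}$; $\Gamma/\Delta$ is derivable from $\mathcal{S}$ if $\Gamma\vdash_\mathcal{S}\Delta$. An m-basis (s-basis) for $L$ is a set of m-rules (rules) from which every m-rule (rule) admissible for $L$ is derivable. A set $\mathcal{S}$ of m-rules is independent if no $s\in\mathcal{S}$ is derivable from $\mathcal{S}\setminus\{s\}$.
   Formalization: Intuitionistic derivability is taken to include Γ ⊢ ∅ whenever Γ derives ⊥; with single conclusions only, the rule ⊥/∅ is admissible for every L but not derivable from the claimed basis. Rules with nonempty conclusion sets are unaffected. *)

theory Defs
  imports Main "HOL-Library.FSet"
begin

section \<open>Formulas\<close>

datatype form =
    Var nat
  | Bot
  | Top
  | Neg form
  | Conj form form
  | Disj form form
  | Imp form form

primrec vars :: "form \<Rightarrow> nat set" where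
  "vars (Var x) = {x}"
| "vars Bot = {}"
| "vars Top = {}"
| "vars (Neg A) = vars A"
| "vars (Conj A B) = vars A \<union> vars B"
| "vars (Disj A B) = vars A \<union> vars B"
| "vars (Imp A B) = vars A \<union> vars B"

primrec subst :: "(nat \<Rightarrow> form) \<Rightarrow> form \<Rightarrow> form" where
  "subst \<sigma> (Var x) = \<sigma> x"
| "subst \<sigma> Bot = Bot"
| "subst \<sigma> Top = Top"
| "subst \<sigma> (Neg A) = Neg (subst \<sigma> A)"
| "subst \<sigma> (Conj A B) = Conj (subst \<sigma> A) (subst \<sigma> B)"
| "subst \<sigma> (Disj A B) = Disj (subst \<sigma> A) (subst \<sigma> B)"
| "subst \<sigma> (Imp A B) = Imp (subst \<sigma> A) (subst \<sigma> B)"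

fun conj_list :: "form list \<Rightarrow> form" where
  "conj_list [] = Top"
| "conj_list [A] = A"
| "conj_list (A # B # As) = Conj A (conj_list (B # As))"

fun disj_list :: "form list \<Rightarrow> form" where
  "disj_list [] = Bot"
| "disj_list [A] = A"
| "disj_list (A # B # As) = Disj A (disj_list (B # As))"

text \<open>The conjunction (disjunction) of a finite set of formulas is formed along a fixed but
  unspecified repetition-free enumeration of the set; different enumerations give
  intuitionistically equivalent formulas.\<close>

definition enum_of :: "form fset \<Rightarrow> form list" where
  "enum_of \<Gamma> = (SOME xs. distinct xs \<and> fset_of_list xs = \<Gamma>)"

definition bigconj :: "form fset \<Rightarrow> form" where
  "bigconj \<Gamma> = conj_list (enum_of \<Gamma>)"

definition bigdisj :: "form fset \<Rightarrow> form" where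
  "bigdisj \<Gamma> = disj_list (enum_of \<Gamma>)"

section \<open>Intuitionistic derivability and intermediate logics\<close>

inductive int_derives :: "form set \<Rightarrow> form \<Rightarrow> bool"  (infix "\<turnstile>\<^sub>I" 50) for H :: "form set" where
  Assm: "A \<in> H \<Longrightarrow> H \<turnstile>\<^sub>I A"
| K: "H \<turnstile>\<^sub>I Imp A (Imp B A)"
| S: "H \<turnstile>\<^sub>I Imp (Imp A (Imp B C)) (Imp (Imp A B) (Imp A C))"
| ConjE1: "H \<turnstile>\<^sub>I Imp (Conj A B) A"
| ConjE2: "H \<turnstile>\<^sub>I Imp (Conj A B) B"
| ConjI: "H \<turnstile>\<^sub>I Imp A (Imp B (Conj A B))"
| DisjI1: "H \<turnstile>\<^sub>I Imp A (Disj A B)"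
| DisjI2: "H \<turnstile>\<^sub>I Imp B (Disj A B)"
| DisjE: "H \<turnstile>\<^sub>I Imp (Imp A C) (Imp (Imp B C) (Imp (Disj A B) C))"
| BotE: "H \<turnstile>\<^sub>I Imp Bot A"
| TopI: "H \<turnstile>\<^sub>I Top"
| NegI: "H \<turnstile>\<^sub>I Imp (Imp A B) (Imp (Imp A (Neg B)) (Neg A))"
| NegE: "H \<turnstile>\<^sub>I Imp (Neg A) (Imp A B)"
| MP: "H \<turnstile>\<^sub>I Imp A B \<Longrightarrow> H \<turnstile>\<^sub>I A \<Longrightarrow> H \<turnstile>\<^sub>I B"

definition Int_logic :: "form set" where
  "Int_logic = {A. {} \<turnstile>\<^sub>I A}"

definition intermediate_logic :: "form set \<Rightarrow> bool" where
  "intermediate_logic L \<longleftrightarrow>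
     Int_logic \<subseteq> L \<and> L \<subset> UNIV \<and>
     (\<forall>A B. Imp A B \<in> L \<longrightarrow> A \<in> L \<longrightarrow> B \<in> L) \<and>
     (\<forall>\<sigma> A. A \<in> L \<longrightarrow> subst \<sigma> A \<in> L)"

definition disjunction_property :: "form set \<Rightarrow> bool" where
  "disjunction_property L \<longleftrightarrow> (\<forall>A B. Disj A B \<in> L \<longrightarrow> A \<in> L \<or> B \<in> L)"

section \<open>Multiple-conclusion rules\<close>

type_synonym mrule = "form fset \<times> form fset"

definition single_conclusion :: "mrule \<Rightarrow> bool" where
  "single_conclusion r \<longleftrightarrow> (\<exists>B. snd r = {|B|})"

definition rule_vars :: "mrule \<Rightarrow> nat set" where
  "rule_vars r = (\<Union>A \<in> fset (fst r) \<union> fset (snd r). vars A)"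

definition admissible :: "form set \<Rightarrow> mrule \<Rightarrow> bool" where
  "admissible L r \<longleftrightarrow>
     (\<forall>\<sigma>. subst \<sigma> ` fset (fst r) \<subseteq> L \<longrightarrow> subst \<sigma> ` fset (snd r) \<inter> L \<noteq> {})"

definition rule_disj :: "nat \<Rightarrow> mrule \<Rightarrow> mrule" where
  "rule_disj q r =
     ({|Disj (bigconj (fst r)) (Var q)|}, {|Disj (bigdisj (snd r)) (Var q)|})"

definition DP_rule :: "nat \<Rightarrow> nat \<Rightarrow> mrule" where
  "DP_rule p q = ({|Disj (Var p) (Var q)|}, {|Var p, Var q|})"

section \<open>Multiple-conclusion consequence and bases\<close>

definition m_consequence :: "(form fset \<Rightarrow> form fset \<Rightarrow> bool) \<Rightarrow> bool" where
  "m_consequence C \<longleftrightarrow>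
     (\<forall>A. C {|A|} {|A|}) \<and>
     (\<forall>\<Gamma> \<Gamma>' \<Delta> \<Delta>'. C \<Gamma> \<Delta> \<longrightarrow> C (\<Gamma> |\<union>| \<Gamma>') (\<Delta> |\<union>| \<Delta>')) \<and>
     (\<forall>\<Gamma> \<Gamma>' \<Delta> \<Delta>' A. C (finsert A \<Gamma>) \<Delta> \<longrightarrow> C \<Gamma>' (finsert A \<Delta>') \<longrightarrow>
        C (\<Gamma> |\<union>| \<Gamma>') (\<Delta> |\<union>| \<Delta>')) \<and>
     (\<forall>\<sigma> \<Gamma> \<Delta>. C \<Gamma> \<Delta> \<longrightarrow> C (subst \<sigma> |`| \<Gamma>) (subst \<sigma> |`| \<Delta>))"

text \<open>Intuitionistic derivability, as a relation between finite sets, has at most one formula on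
  the right, and the empty right-hand side stands for \<open>Bot\<close> (as in the sequent calculus LJ).
  In particular \<open>{|Bot|}\<close> entails \<open>{||}\<close>. Without this clause no m-rule with an empty
  conclusion would be derivable from rules with nonempty conclusions, although
  \<open>({|Bot|}, {||})\<close> is admissible for every intermediate logic. Right-hand sides with several
  formulas are not read disjunctively: that would make \<open>DP_rule\<close> derivable outright.\<close>

definition int_sequent :: "form fset \<Rightarrow> form fset \<Rightarrow> bool" where
  "int_sequent \<Gamma> \<Delta> \<longleftrightarrow>
     (\<exists>B. \<Delta> = {|B|} \<and> fset \<Gamma> \<turnstile>\<^sub>I B) \<or> (\<Delta> = {||} \<and> fset \<Gamma> \<turnstile>\<^sub>I Bot)"

definition m_closed :: "mrule set \<Rightarrow> (form fset \<Rightarrow> form fset \<Rightarrow> bool) \<Rightarrow> bool" where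
  "m_closed \<S> C \<longleftrightarrow>
     m_consequence C \<and> (\<forall>\<Gamma> \<Delta>. int_sequent \<Gamma> \<Delta> \<longrightarrow> C \<Gamma> \<Delta>) \<and> (\<forall>(\<Gamma>, \<Delta>) \<in> \<S>. C \<Gamma> \<Delta>)"

definition m_derives :: "mrule set \<Rightarrow> form fset \<Rightarrow> form fset \<Rightarrow> bool" where
  "m_derives \<S> \<Gamma> \<Delta> \<longleftrightarrow> (\<forall>C. m_closed \<S> C \<longrightarrow> C \<Gamma> \<Delta>)"

lemma m_derives_closed: "m_closed \<S> (m_derives \<S>)"
proof -
  have cut: "m_derives \<S> (\<Gamma> |\<union>| \<Gamma>') (\<Delta> |\<union>| \<Delta>')"
    if "m_derives \<S> (finsert A \<Gamma>) \<Delta>" "m_derives \<S> \<Gamma>' (finsert A \<Delta>')" for \<Gamma> \<Gamma>' \<Delta> \<Delta>' A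
    unfolding m_derives_def
  proof (intro allI impI)
    fix C assume C: "m_closed \<S> C"
    then have "C (finsert A \<Gamma>) \<Delta>" "C \<Gamma>' (finsert A \<Delta>')"
      using that by (auto simp: m_derives_def)
    moreover have "m_consequence C"
      using C by (simp add: m_closed_def)
    ultimately show "C (\<Gamma> |\<union>| \<Gamma>') (\<Delta> |\<union>| \<Delta>')"
      unfolding m_consequence_def by metis
  qed
  have "m_consequence (m_derives \<S>)"
    unfolding m_consequence_def
  proof (intro conjI allI impI)
    show "m_derives \<S> {|A|} {|A|}" for A
      by (simp add: m_derives_def m_closed_def m_consequence_def)
    show "m_derives \<S> (\<Gamma> |\<union>| \<Gamma>') (\<Delta> |\<union>| \<Delta>')" if "m_derives \<S> \<Gamma> \<Delta>" for \<Gamma> \<Gamma>' \<Delta> \<Delta>'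
      using that unfolding m_derives_def by (meson m_closed_def m_consequence_def)
    show "m_derives \<S> (subst \<sigma> |`| \<Gamma>) (subst \<sigma> |`| \<Delta>)" if "m_derives \<S> \<Gamma> \<Delta>" for \<sigma> \<Gamma> \<Delta>
      using that unfolding m_derives_def by (meson m_closed_def m_consequence_def)
  qed (rule cut)
  then show ?thesis
    by (auto simp: m_closed_def [of \<S> "m_derives \<S>"])
       (auto simp: m_derives_def m_closed_def)
qed

definition derivable_from :: "mrule set \<Rightarrow> mrule \<Rightarrow> bool" where
  "derivable_from \<S> r \<longleftrightarrow> m_derives \<S> (fst r) (snd r)"

definition m_basis :: "form set \<Rightarrow> mrule set \<Rightarrow> bool" where
  "m_basis L \<S> \<longleftrightarrow> (\<forall>r. admissible L r \<longrightarrow> derivable_from \<S> r)"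

definition s_basis :: "form set \<Rightarrow> mrule set \<Rightarrow> bool" where
  "s_basis L \<S> \<longleftrightarrow>
     (\<forall>r \<in> \<S>. single_conclusion r) \<and>
     (\<forall>r. single_conclusion r \<longrightarrow> admissible L r \<longrightarrow> derivable_from \<S> r)"

definition independent :: "mrule set \<Rightarrow> bool" where
  "independent \<S> \<longleftrightarrow> (\<forall>s \<in> \<S>. \<not> derivable_from (\<S> - {s}) s)"

end

(*
  A set T of formulas that is closed under intuitionistic deduction and does not contain Bot defines
  an m-consequence: all m-rules "admissible for T", where T need not be closed under substitution.
  So an m-rule not admissible for such a T is not derivable from m-rules admissible for T.

  Independence of DP: take T to be all F such that p \<or> q' / F is admissible for L.
  Independence of r^q: extend the consequences of its premise under the remaining rules to a theory T
  maximal among those omitting its conclusion. For any G the set {E. E \<or> G \<in> T} is again a theory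
  closed under rules of the form s^q (substitute q \<or> G for q), and maximality of T then makes T
  prime, that is, closed under DP.

  Completeness: if an m-rule is admissible, then so is the rule from the conjunction of its premises
  to the disjunction of its conclusions, and DP splits that disjunction.
*)
theory Submission
  imports Defs
begin

section \<open>Intuitionistic theories\<close>

text \<open>Closure under substitution is left out on purpose: consequences of a fixed formula,
  residuals and prime extensions generally lack it.\<close>

definition int_theory :: "form set \<Rightarrow> bool" where
  "int_theory T \<longleftrightarrow> Int_logic \<subseteq> T \<and> (\<forall>A B. Imp A B \<in> T \<longrightarrow> A \<in> T \<longrightarrow> B \<in> T)"

section \<open>Deduction theorem and derived rules for disjunction\<close>

lemma int_derives_Imp_refl: "H \<turnstile>\<^sub>I Imp A A"
  by (meson int_derives.K int_derives.S int_derives.MP)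

lemma int_derives_Imp_weaken: "H \<turnstile>\<^sub>I B \<Longrightarrow> H \<turnstile>\<^sub>I Imp A B"
  by (meson int_derives.K int_derives.MP)

lemma deduction: "insert A H \<turnstile>\<^sub>I B \<Longrightarrow> H \<turnstile>\<^sub>I Imp A B"
proof (induction rule: int_derives.induct)
  case (Assm B)
  then show ?case
    using int_derives_Imp_refl int_derives_Imp_weaken int_derives.Assm by blast
next
  case (MP B C)
  then show ?case
    by (meson int_derives.S int_derives.MP)
qed (blast intro: int_derives_Imp_weaken int_derives.intros)+

lemma int_derives_DisjE:
  assumes "insert A H \<turnstile>\<^sub>I C" "insert B H \<turnstile>\<^sub>I C" "H \<turnstile>\<^sub>I Disj A B"
  shows "H \<turnstile>\<^sub>I C"
  by (meson assms deduction int_derives.DisjE int_derives.MP)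

lemma int_derives_DisjI1: "H \<turnstile>\<^sub>I A \<Longrightarrow> H \<turnstile>\<^sub>I Disj A B"
  by (meson int_derives.DisjI1 int_derives.MP)

lemma int_derives_DisjI2: "H \<turnstile>\<^sub>I B \<Longrightarrow> H \<turnstile>\<^sub>I Disj A B"
  by (meson int_derives.DisjI2 int_derives.MP)

text \<open>Axiom schemes are stable under substitution, so a derivation can be substituted line by
  line. Only the instances of its hypotheses have to lie in \<open>T\<close>.\<close>

lemma int_derives_subst_mem:
  assumes "int_theory T" "H \<turnstile>\<^sub>I A" "subst \<tau> ` H \<subseteq> T"
  shows "subst \<tau> A \<in> T"
  using assms(2)
proof (induction rule: int_derives.induct)
  case (Assm A)
  then show ?case using assms(3) by blast
next
  case (MP A B)
  then show ?case using assms(1) by (simp add: int_theory_def)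
qed (use assms(1) in \<open>auto simp: int_theory_def Int_logic_def intro: int_derives.intros\<close>)

lemma subst_Var: "subst Var A = A"
  by (induction A) auto

lemma subst_subst: "subst \<sigma> (subst \<tau> A) = subst (\<lambda>x. subst \<sigma> (\<tau> x)) A"
  by (induction A) auto

lemma subst_cong: "(\<And>x. x \<in> vars A \<Longrightarrow> \<sigma> x = \<tau> x) \<Longrightarrow> subst \<sigma> A = subst \<tau> A"
  by (induction A) auto

lemma int_theory_derives:
  assumes "int_theory T" "H \<turnstile>\<^sub>I A" "H \<subseteq> T"
  shows "A \<in> T"
  using int_derives_subst_mem[of T H A Var] assms by (simp add: subst_Var)

lemma int_theory_BotE: "int_theory T \<Longrightarrow> Bot \<in> T \<Longrightarrow> A \<in> T"
  by (rule int_theory_derives[of T "{Bot}"]) (auto intro: int_derives.intros)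

lemma int_theory_DisjI:
  assumes "int_theory T" "A \<in> T"
  shows "Disj A B \<in> T" "Disj B A \<in> T"
  by (rule int_theory_derives[OF assms(1), of "{A}"];
      use assms(2) in \<open>auto intro: int_derives_DisjI1 int_derives_DisjI2 int_derives.Assm\<close>)+

lemma int_theory_Disj_commute:
  assumes "int_theory T" "Disj A B \<in> T"
  shows "Disj B A \<in> T"
  by (rule int_theory_derives[OF assms(1), of "{Disj A B}"], rule int_derives_DisjE[of A _ _ B])
    (use assms(2) in \<open>auto intro: int_derives_DisjI1 int_derives_DisjI2 int_derives.Assm\<close>)

lemma int_theory_Disj_idem:
  assumes "int_theory T" "Disj A A \<in> T"
  shows "A \<in> T"
  by (rule int_theory_derives[OF assms(1), of "{Disj A A}"], rule int_derives_DisjE[of A _ _ A])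
    (use assms(2) in \<open>auto intro: int_derives.Assm\<close>)

text \<open>Lets a side disjunct \<open>C\<close> be absorbed into the disjunct \<open>B\<close>;
  later \<open>B\<close> is the value of the variable \<open>q\<close>.\<close>

lemma int_theory_Disj_assoc:
  assumes "int_theory T"
  shows "Disj (Disj A B) C \<in> T \<longleftrightarrow> Disj A (Disj B C) \<in> T"
proof
  assume *: "Disj (Disj A B) C \<in> T"
  have "{Disj (Disj A B) C} \<turnstile>\<^sub>I Disj A (Disj B C)"
    by (rule int_derives_DisjE[of "Disj A B" _ _ C], rule int_derives_DisjE[of A _ _ B])
      (auto intro: int_derives_DisjI1 int_derives_DisjI2 int_derives.Assm)
  then show "Disj A (Disj B C) \<in> T"
    using * int_theory_derives[OF assms] by blast
next
  assume *: "Disj A (Disj B C) \<in> T"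
  have "{Disj A (Disj B C)} \<turnstile>\<^sub>I Disj (Disj A B) C"
  proof (rule int_derives_DisjE[of A _ _ "Disj B C"])
    show "insert (Disj B C) {Disj A (Disj B C)} \<turnstile>\<^sub>I Disj (Disj A B) C"
      by (rule int_derives_DisjE[of B _ _ C])
        (auto intro: int_derives_DisjI1 int_derives_DisjI2 int_derives.Assm)
  qed (auto intro: int_derives_DisjI1 int_derives_DisjI2 int_derives.Assm)
  then show "Disj (Disj A B) C \<in> T"
    using * int_theory_derives[OF assms] by blast
qed

text \<open>Modus ponens survives a side disjunct \<open>G\<close>: if either premise holds by way
  of \<open>G\<close>, so does the conclusion, and otherwise it is ordinary modus ponens.\<close>

lemma int_theory_Disj_residual:
  assumes "int_theory T"
  shows "int_theory {E. Disj E G \<in> T}"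
  unfolding int_theory_def
proof (intro conjI allI impI)
  show "Int_logic \<subseteq> {E. Disj E G \<in> T}"
    using assms int_theory_DisjI[OF assms] by (auto simp: int_theory_def)
next
  fix A B assume *: "Imp A B \<in> {E. Disj E G \<in> T}" "A \<in> {E. Disj E G \<in> T}"
  let ?H = "{Disj (Imp A B) G, Disj A G}"
  have "?H \<turnstile>\<^sub>I Disj B G"
  proof (rule int_derives_DisjE[of "Imp A B" _ _ G])
    show "insert (Imp A B) ?H \<turnstile>\<^sub>I Disj B G"
    proof (rule int_derives_DisjE[of A _ _ G])
      show "insert A (insert (Imp A B) ?H) \<turnstile>\<^sub>I Disj B G"
        by (rule int_derives_DisjI1, rule int_derives.MP[of _ A]) (auto intro: int_derives.Assm)
    qed (auto intro: int_derives_DisjI2 int_derives.Assm)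
  qed (auto intro: int_derives_DisjI2 int_derives.Assm)
  then show "B \<in> {E. Disj E G \<in> T}"
    using * int_theory_derives[OF assms] by blast
qed

section \<open>Finite conjunctions and disjunctions\<close>

lemma fset_of_list_enum_of: "fset_of_list (enum_of \<Gamma>) = \<Gamma>"
proof -
  obtain xs where "set xs = fset \<Gamma>" "distinct xs"
    using finite_distinct_list[of "fset \<Gamma>"] by auto
  then have "distinct xs \<and> fset_of_list xs = \<Gamma>"
    by (simp add: fset_of_list.rep_eq fset_inject[symmetric])
  then show ?thesis
    unfolding enum_of_def by (rule someI2) simp
qed

lemma set_enum_of: "set (enum_of \<Gamma>) = fset \<Gamma>"
  by (metis fset_of_list_enum_of fset_of_list.rep_eq)

lemma vars_conj_list: "vars (conj_list xs) = (\<Union>A \<in> set xs. vars A)"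
  by (induction xs rule: conj_list.induct) auto

lemma vars_disj_list: "vars (disj_list xs) = (\<Union>A \<in> set xs. vars A)"
  by (induction xs rule: disj_list.induct) auto

text \<open>Carries freshness of a variable for \<open>r\<close> over to the two formulas from which
  \<open>rule_disj\<close> is built.\<close>

lemma vars_big_subset_rule_vars:
  "vars (bigconj (fst r)) \<subseteq> rule_vars r" "vars (bigdisj (snd r)) \<subseteq> rule_vars r"
  by (auto simp: bigconj_def bigdisj_def vars_conj_list vars_disj_list set_enum_of rule_vars_def)

lemma int_derives_conj_list: "set xs \<subseteq> H \<Longrightarrow> H \<turnstile>\<^sub>I conj_list xs"
proof (induction xs rule: conj_list.induct)
  case (3 A B As)
  then have "H \<turnstile>\<^sub>I A" "H \<turnstile>\<^sub>I conj_list (B # As)"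
    by (auto intro: int_derives.Assm)
  then show ?case
    by (simp, meson int_derives.ConjI int_derives.MP)
qed (auto intro: int_derives.intros)

lemma conj_list_int_derives: "A \<in> set xs \<Longrightarrow> H \<turnstile>\<^sub>I conj_list xs \<Longrightarrow> H \<turnstile>\<^sub>I A"
proof (induction xs rule: conj_list.induct)
  case (3 B C Cs)
  then have "H \<turnstile>\<^sub>I B" "H \<turnstile>\<^sub>I conj_list (C # Cs)"
    by (simp_all, (meson int_derives.ConjE1 int_derives.ConjE2 int_derives.MP)+)
  then show ?case
    using 3 by auto
qed auto

lemma int_derives_disj_list: "A \<in> set xs \<Longrightarrow> H \<turnstile>\<^sub>I A \<Longrightarrow> H \<turnstile>\<^sub>I disj_list xs"
  by (induction xs rule: disj_list.induct) (auto intro: int_derives_DisjI1 int_derives_DisjI2)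

lemma int_derives_bigconj: "fset \<Gamma> \<turnstile>\<^sub>I bigconj \<Gamma>"
  by (simp add: bigconj_def int_derives_conj_list set_enum_of)

lemma bigconj_int_derives: "A \<in> fset \<Gamma> \<Longrightarrow> {bigconj \<Gamma>} \<turnstile>\<^sub>I A"
  unfolding bigconj_def
  by (rule conj_list_int_derives[of _ "enum_of \<Gamma>"]) (auto simp: set_enum_of intro: int_derives.Assm)

lemma int_derives_bigdisj: "B \<in> fset \<Delta> \<Longrightarrow> {B} \<turnstile>\<^sub>I bigdisj \<Delta>"
  unfolding bigdisj_def
  by (rule int_derives_disj_list[of B]) (auto simp: set_enum_of intro: int_derives.Assm)

section \<open>Derivability and admissibility of m-rules\<close>

lemma admissible_single:
  "admissible T ({|A|}, {|B|}) \<longleftrightarrow> (\<forall>\<sigma>. subst \<sigma> A \<in> T \<longrightarrow> subst \<sigma> B \<in> T)"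
  by (auto simp: admissible_def)

text \<open>Admissibility for \<open>T\<close> is itself an m-consequence containing
  \<open>int_sequent\<close> and \<open>\<S>\<close>, while \<open>m_derives\<close> is the least
  one. Closure under substitution costs nothing, because \<open>admissible\<close> already
  quantifies over all substitutions.\<close>

lemma derivable_from_admissible:
  assumes T: "int_theory T" "Bot \<notin> T"
    and \<S>: "\<And>s. s \<in> \<S> \<Longrightarrow> admissible T s"
    and r: "derivable_from \<S> r"
  shows "admissible T r"
proof -
  let ?C = "\<lambda>\<Gamma> \<Delta>. admissible T (\<Gamma>, \<Delta>)"
  have "m_consequence ?C"
    unfolding m_consequence_def
  proof (intro conjI allI impI)
    show "?C (\<Gamma> |\<union>| \<Gamma>') (\<Delta> |\<union>| \<Delta>')" if "?C \<Gamma> \<Delta>" for \<Gamma> \<Gamma>' \<Delta> \<Delta>'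
      unfolding admissible_def
    proof (intro allI impI)
      fix \<sigma> assume "subst \<sigma> ` fset (fst (\<Gamma> |\<union>| \<Gamma>', \<Delta> |\<union>| \<Delta>')) \<subseteq> T"
      then have "subst \<sigma> ` fset \<Gamma> \<subseteq> T"
        by (simp add: image_Un)
      then have "subst \<sigma> ` fset \<Delta> \<inter> T \<noteq> {}"
        using that by (simp add: admissible_def)
      then show "subst \<sigma> ` fset (snd (\<Gamma> |\<union>| \<Gamma>', \<Delta> |\<union>| \<Delta>')) \<inter> T \<noteq> {}"
        by (simp add: image_Un Int_Un_distrib2)
    qed
    show "?C (\<Gamma> |\<union>| \<Gamma>') (\<Delta> |\<union>| \<Delta>')"
      if l: "?C (finsert A \<Gamma>) \<Delta>" and r: "?C \<Gamma>' (finsert A \<Delta>')" for \<Gamma> \<Gamma>' \<Delta> \<Delta>' A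
      unfolding admissible_def
    proof (intro allI impI)
      fix \<sigma> assume "subst \<sigma> ` fset (fst (\<Gamma> |\<union>| \<Gamma>', \<Delta> |\<union>| \<Delta>')) \<subseteq> T"
      then have *: "subst \<sigma> ` fset \<Gamma> \<subseteq> T" "subst \<sigma> ` fset \<Gamma>' \<subseteq> T"
        by (simp_all add: image_Un)
      \<comment> \<open>Cut is a case split on whether the instance of the cut formula lies in
        \<open>T\<close>.\<close>
      have "subst \<sigma> ` fset \<Delta> \<inter> T \<noteq> {} \<or> subst \<sigma> ` fset \<Delta>' \<inter> T \<noteq> {}"
      proof (cases "subst \<sigma> A \<in> T")
        case True
        then show ?thesis
          using l *(1) by (simp add: admissible_def)
      next
        case False
        then show ?thesis
          using spec[OF r[unfolded admissible_def], of \<sigma>] *(2) by simp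
      qed
      then show "subst \<sigma> ` fset (snd (\<Gamma> |\<union>| \<Gamma>', \<Delta> |\<union>| \<Delta>')) \<inter> T \<noteq> {}"
        by (auto simp: image_Un Int_Un_distrib2)
    qed
    show "?C (subst \<sigma> |`| \<Gamma>) (subst \<sigma> |`| \<Delta>)" if "?C \<Gamma> \<Delta>" for \<sigma> \<Gamma> \<Delta>
      using that by (simp add: admissible_def image_image subst_subst)
  qed (simp add: admissible_def)
  \<comment> \<open>\<open>Bot \<notin> T\<close> handles the empty right-hand side: there the
    premises cannot all lie in \<open>T\<close>.\<close>
  moreover have "?C \<Gamma> \<Delta>" if "int_sequent \<Gamma> \<Delta>" for \<Gamma> \<Delta>
    using that int_derives_subst_mem[OF T(1), of "fset \<Gamma>" Bot] T(2)
      int_derives_subst_mem[OF T(1), of "fset \<Gamma>"]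
    unfolding int_sequent_def admissible_def by auto
  ultimately have "m_closed \<S> ?C"
    using \<S> by (auto simp: m_closed_def)
  then show ?thesis
    using r by (cases r) (auto simp: derivable_from_def m_derives_def)
qed

section \<open>Structural rules of \<open>m_derives\<close> and the theory of consequences of one
  formula\<close>

lemma m_derives_mono: "\<S> \<subseteq> \<S>' \<Longrightarrow> m_derives \<S> \<Gamma> \<Delta> \<Longrightarrow> m_derives \<S>' \<Gamma> \<Delta>"
  unfolding m_derives_def m_closed_def by blast

lemma m_derives_rule: "(\<Gamma>, \<Delta>) \<in> \<S> \<Longrightarrow> m_derives \<S> \<Gamma> \<Delta>"
  using m_derives_closed[of \<S>] unfolding m_closed_def by blast

lemma m_derives_int: "int_sequent \<Gamma> \<Delta> \<Longrightarrow> m_derives \<S> \<Gamma> \<Delta>"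
  using m_derives_closed[of \<S>] unfolding m_closed_def by blast

lemma m_derives_subst:
  "m_derives \<S> \<Gamma> \<Delta> \<Longrightarrow> m_derives \<S> (subst \<sigma> |`| \<Gamma>) (subst \<sigma> |`| \<Delta>)"
  using m_derives_closed[of \<S>] unfolding m_closed_def m_consequence_def by blast

lemma m_derives_refl: "m_derives \<S> {|A|} {|A|}"
  using m_derives_closed[of \<S>] unfolding m_closed_def m_consequence_def by blast

lemma m_derives_cut:
  "m_derives \<S> (finsert A \<Gamma>) \<Delta> \<Longrightarrow> m_derives \<S> \<Gamma>' (finsert A \<Delta>') \<Longrightarrow>
    m_derives \<S> (\<Gamma> |\<union>| \<Gamma>') (\<Delta> |\<union>| \<Delta>')"
  using m_derives_closed[of \<S>] unfolding m_closed_def m_consequence_def by metis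

lemma m_derives_trans:
  "m_derives \<S> \<Gamma> {|A|} \<Longrightarrow> m_derives \<S> {|A|} \<Delta> \<Longrightarrow> m_derives \<S> \<Gamma> \<Delta>"
  using m_derives_cut[of \<S> A "{||}" \<Delta> \<Gamma> "{||}"] by simp

lemma int_theory_m_derives: "int_theory {F. m_derives \<S> {|A|} {|F|}}"
  unfolding int_theory_def
proof (intro conjI allI impI subsetI)
  fix F assume "F \<in> Int_logic"
  then have "{} \<turnstile>\<^sub>I Imp A F"
    using int_derives_Imp_weaken by (auto simp: Int_logic_def)
  \<comment> \<open>Weakening: members of \<open>Int_logic\<close> are derived from no hypotheses,
    whereas here \<open>A\<close> is available.\<close>
  moreover have "{A} \<turnstile>\<^sub>I G" if "{} \<turnstile>\<^sub>I G" for G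
    using that by (induction rule: int_derives.induct) (blast intro: int_derives.intros)+
  ultimately have "{A} \<turnstile>\<^sub>I F"
    by (meson int_derives.Assm int_derives.MP singletonI)
  then show "F \<in> {F. m_derives \<S> {|A|} {|F|}}"
    by (simp add: m_derives_int int_sequent_def)
next
  fix F G
  assume *: "Imp F G \<in> {F. m_derives \<S> {|A|} {|F|}}" "F \<in> {F. m_derives \<S> {|A|} {|F|}}"
  have "{Imp F G, F} \<turnstile>\<^sub>I G"
    by (rule int_derives.MP[of _ F]) (auto intro: int_derives.Assm)
  then have "m_derives \<S> {|Imp F G, F|} {|G|}"
    by (simp add: m_derives_int int_sequent_def)
  \<comment> \<open>Two cuts remove \<open>Imp F G\<close> and then \<open>F\<close>; the copies of
    \<open>A\<close> they bring in merge, as left-hand sides are sets.\<close>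
  then have "m_derives \<S> {|F, A|} {|G|}"
    using * m_derives_cut[of \<S> "Imp F G" "{|F|}" "{|G|}" "{|A|}" "{||}"]
    by (simp add: finsert_commute)
  then show "G \<in> {F. m_derives \<S> {|A|} {|F|}}"
    using * m_derives_cut[of \<S> F "{|A|}" "{|G|}" "{|A|}" "{||}"] by simp
qed

text \<open>With one premise and one conclusion, an instance of \<open>s\<close> is a single link
  that prolongs a derivation from \<open>C\<close> by transitivity.\<close>

lemma admissible_m_derives:
  assumes "single_conclusion s" "\<exists>A. fst s = {|A|}" "s \<in> \<S>"
  shows "admissible {F. m_derives \<S> {|C|} {|F|}} s"
proof -
  obtain A B where s: "s = ({|A|}, {|B|})"
    using assms(1,2) by (cases s) (auto simp: single_conclusion_def)
  have "m_derives \<S> {|subst \<sigma> A|} {|subst \<sigma> B|}" for \<sigma>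
    using m_derives_subst[OF m_derives_rule[of "{|A|}" "{|B|}" \<S>], of \<sigma>] assms(3) s by simp
  then show ?thesis
    unfolding s admissible_single using m_derives_trans by blast
qed

text \<open>The disjunct \<open>G\<close> is hidden in \<open>q\<close>: changing \<sigma> at
  \<open>q\<close> to \<open>Disj (\<sigma> q) G\<close> leaves the rest of the rule alone by
  freshness, and associativity turns the instance over \<open>T\<close> into one over the
  residual.\<close>

lemma admissible_Disj_residual:
  assumes T: "int_theory T" and adm: "admissible T (rule_disj q r)" and q: "q \<notin> rule_vars r"
  shows "admissible {E. Disj E G \<in> T} (rule_disj q r)"
  unfolding rule_disj_def admissible_single
proof (intro allI impI)
  fix \<sigma>
  let ?\<sigma>' = "\<sigma>(q := Disj (\<sigma> q) G)"
  let ?A = "bigconj (fst r)" and ?B = "bigdisj (snd r)"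
  have eq: "subst ?\<sigma>' ?A = subst \<sigma> ?A" "subst ?\<sigma>' ?B = subst \<sigma> ?B"
    using q vars_big_subset_rule_vars[of r] by (auto intro!: subst_cong)
  assume "subst \<sigma> (Disj ?A (Var q)) \<in> {E. Disj E G \<in> T}"
  then have "subst ?\<sigma>' (Disj ?A (Var q)) \<in> T"
    by (simp add: int_theory_Disj_assoc[OF T] eq)
  then have "subst ?\<sigma>' (Disj ?B (Var q)) \<in> T"
    using adm unfolding rule_disj_def admissible_single by blast
  then show "subst \<sigma> (Disj ?B (Var q)) \<in> {E. Disj E G \<in> T}"
    by (simp add: int_theory_Disj_assoc[OF T] eq)
qed

section \<open>Prime extensions\<close>

text \<open>Both premises of modus ponens lie in a common member of the chain, and a rule with one
  premise is tested inside one member. This supplies the upper bounds for Zorn's lemma.\<close>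

lemma Union_chain_theory:
  assumes c: "subset.chain {T. int_theory T \<and> (\<forall>s \<in> \<S>. admissible T s)} \<C>" and "\<C> \<noteq> {}"
    and single: "\<And>s. s \<in> \<S> \<Longrightarrow> \<exists>A B. s = ({|A|}, {|B|})"
  shows "int_theory (\<Union>\<C>) \<and> (\<forall>s \<in> \<S>. admissible (\<Union>\<C>) s)"
proof (intro conjI ballI)
  have mem: "int_theory T" "\<forall>s \<in> \<S>. admissible T s" if "T \<in> \<C>" for T
    using c that by (auto simp: subset.chain_def)
  show "int_theory (\<Union>\<C>)"
    unfolding int_theory_def
  proof (intro conjI allI impI)
    show "Int_logic \<subseteq> \<Union>\<C>"
      using mem(1) \<open>\<C> \<noteq> {}\<close> by (auto simp: int_theory_def)
    fix A B assume "Imp A B \<in> \<Union>\<C>" "A \<in> \<Union>\<C>"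
    then obtain T1 T2 where T: "T1 \<in> \<C>" "T2 \<in> \<C>" "Imp A B \<in> T1" "A \<in> T2"
      by blast
    then have "T1 \<subseteq> T2 \<or> T2 \<subseteq> T1"
      using c by (auto simp: subset_chain_def)
    then obtain T where "T \<in> \<C>" "Imp A B \<in> T" "A \<in> T"
      using T by blast
    then show "B \<in> \<Union>\<C>"
      using mem(1) unfolding int_theory_def by blast
  qed
  show "admissible (\<Union>\<C>) s" if s: "s \<in> \<S>" for s
  proof -
    obtain A B where "s = ({|A|}, {|B|})"
      using single[OF s] by blast
    then show ?thesis
      using mem(2) s by (fastforce simp: admissible_single)
  qed
qed

lemma prime_extension:
  assumes T0: "int_theory T0" "\<And>s. s \<in> \<S> \<Longrightarrow> admissible T0 s" "F \<notin> T0"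
    and form: "\<And>s. s \<in> \<S> \<Longrightarrow> \<exists>r. s = rule_disj q r \<and> q \<notin> rule_vars r"
  obtains T where "T0 \<subseteq> T" "int_theory T" "\<And>s. s \<in> \<S> \<Longrightarrow> admissible T s" "F \<notin> T"
    "disjunction_property T"
proof -
  let ?P = "{T. int_theory T \<and> (\<forall>s \<in> \<S>. admissible T s)}"
  let ?Q = "{T \<in> ?P. T0 \<subseteq> T \<and> F \<notin> T}"
  have "\<exists>M\<in>?Q. \<forall>X\<in>?Q. M \<subseteq> X \<longrightarrow> X = M"
  proof (rule subset_Zorn_nonempty)
    show "?Q \<noteq> {}"
      using T0 by blast
    fix \<C> assume ne: "\<C> \<noteq> {}" and c: "subset.chain ?Q \<C>"
    then have "subset.chain ?P \<C>"
      by (auto simp: subset.chain_def)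
    moreover have "\<exists>A B. s = ({|A|}, {|B|})" if "s \<in> \<S>" for s
      using form[OF that] by (auto simp: rule_disj_def)
    ultimately have "\<Union>\<C> \<in> ?P"
      using Union_chain_theory[of \<S> \<C>] ne by blast
    moreover have "T0 \<subseteq> \<Union>\<C>" "F \<notin> \<Union>\<C>"
      using c ne unfolding subset.chain_def by blast+
    ultimately show "\<Union>\<C> \<in> ?Q"
      by blast
  qed
  then obtain T where T: "T \<in> ?Q" and max: "\<forall>X\<in>?Q. T \<subseteq> X \<longrightarrow> X = T"
    by (rule bexE)
  have th: "int_theory T" and adm: "\<And>s. s \<in> \<S> \<Longrightarrow> admissible T s"
    and sub: "T0 \<subseteq> T" and F: "F \<notin> T"
    using T by simp_all
  \<comment> \<open>The residual of \<open>T\<close> by \<open>G\<close> contains \<open>T\<close>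
    and also \<open>E\<close>, hence is strictly larger; by maximality it must contain
    \<open>F\<close>.\<close>
  have F_residual: "Disj F G \<in> T" if "Disj E G \<in> T" "E \<notin> T" for E G
  proof (rule ccontr)
    let ?X = "{E. Disj E G \<in> T}"
    assume "Disj F G \<notin> T"
    moreover have "T \<subseteq> ?X"
      using int_theory_DisjI[OF th] by auto
    moreover have "admissible ?X s" if "s \<in> \<S>" for s
      using form[OF that] adm[OF that] admissible_Disj_residual[OF th] by blast
    ultimately have "?X \<in> ?Q"
      using sub int_theory_Disj_residual[OF th] by simp
    then have "?X = T"
      using bspec[OF max] \<open>T \<subseteq> ?X\<close> by simp
    then show False
      using that by blast
  qed
  have "disjunction_property T"
    unfolding disjunction_property_def
  proof (intro allI impI, rule ccontr)
    \<comment> \<open>\<open>F_residual\<close> is used twice, replacing first \<open>A\<close> and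
      then \<open>B\<close> by \<open>F\<close>, which ends in \<open>Disj F F\<close>.\<close>
    fix A B assume "Disj A B \<in> T" and not: "\<not> (A \<in> T \<or> B \<in> T)"
    then have "Disj B F \<in> T"
      using F_residual int_theory_Disj_commute[OF th] by blast
    then have "F \<in> T"
      using F_residual not int_theory_Disj_idem[OF th] by blast
    then show False
      using F by blast
  qed
  then show thesis
    using that[of T] sub th adm F by simp
qed

section \<open>Independence and completeness\<close>

lemma DP_rule_admissible: "disjunction_property T \<Longrightarrow> admissible T (DP_rule p q)"
  by (auto simp: admissible_def DP_rule_def disjunction_property_def)

lemma intermediate_logic_int_theory: "intermediate_logic L \<Longrightarrow> int_theory L"
  by (simp add: intermediate_logic_def int_theory_def)

lemma intermediate_logic_Bot: "intermediate_logic L \<Longrightarrow> Bot \<notin> L"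
  using int_theory_BotE[OF intermediate_logic_int_theory, of L]
  unfolding intermediate_logic_def by blast

text \<open>Rules with one conclusion pass from \<open>L\<close> to the theory \<open>T\<close> by
  composing substitutions. For several conclusions this breaks down, since the conclusion that holds
  may vary with the substitution.\<close>

lemma DP_rule_not_derivable:
  assumes L: "intermediate_logic L" and "p \<noteq> q"
    and \<S>: "\<And>s. s \<in> \<S> \<Longrightarrow> single_conclusion s \<and> admissible L s"
  shows "\<not> derivable_from \<S> (DP_rule p q)"
proof
  define T where "T = {F. \<forall>\<sigma>. subst \<sigma> (Disj (Var p) (Var q)) \<in> L \<longrightarrow> subst \<sigma> F \<in> L}"
  note th = intermediate_logic_int_theory[OF L]
  have Top: "Top \<in> L"
    using th by (auto simp: int_theory_def Int_logic_def intro: int_derives.TopI)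
  \<comment> \<open>Such a \<sigma> makes the disjunction of \<open>p\<close> and \<open>q\<close> a
    member of \<open>L\<close> and \<open>F\<close> a non-member. Sending one of the two variables
    to \<open>Bot\<close> and the rest to \<open>Top\<close> refutes that variable.\<close>
  have notin: "F \<notin> T" if "\<sigma> p = Top \<or> \<sigma> q = Top" "subst \<sigma> F = Bot" for F \<sigma>
    using that int_theory_DisjI[OF th Top] intermediate_logic_Bot[OF L]
    by (auto simp: T_def intro!: exI[of _ \<sigma>])
  have "Var p \<notin> T" "Var q \<notin> T" "Bot \<notin> T"
    using \<open>p \<noteq> q\<close> notin[of "\<lambda>x. if x = p then Bot else Top" "Var p"]
      notin[of "\<lambda>x. if x = q then Bot else Top" "Var q"] notin[of "\<lambda>x. Top" Bot] by auto
  have "int_theory T"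
    using L by (auto simp: T_def int_theory_def intermediate_logic_def)
  moreover have "admissible T s" if "s \<in> \<S>" for s
  proof -
    have "single_conclusion s" and adm: "admissible L s"
      using \<S>[OF that] by auto
    then obtain \<Gamma> B where s: "s = (\<Gamma>, {|B|})"
      by (cases s) (auto simp: single_conclusion_def)
    show ?thesis
      unfolding admissible_def
    proof (intro allI impI)
      fix \<tau> assume *: "subst \<tau> ` fset (fst s) \<subseteq> T"
      have "subst \<tau> B \<in> T"
        unfolding T_def
      proof (intro CollectI allI impI)
        fix \<sigma> assume "subst \<sigma> (Disj (Var p) (Var q)) \<in> L"
        \<comment> \<open>Admissibility of \<open>s\<close> for \<open>L\<close> is applied at the
          composite of \<tau> followed by \<sigma>.\<close>
        then have "subst (\<lambda>x. subst \<sigma> (\<tau> x)) ` fset \<Gamma> \<subseteq> L"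
          using * s by (auto simp: T_def subst_subst)
        then show "subst \<sigma> (subst \<tau> B) \<in> L"
          using adm s by (auto simp: admissible_def subst_subst)
      qed
      then show "subst \<tau> ` fset (snd s) \<inter> T \<noteq> {}"
        by (simp add: s)
    qed
  qed
  moreover assume "derivable_from \<S> (DP_rule p q)"
  ultimately have "admissible T (DP_rule p q)"
    using derivable_from_admissible \<open>Bot \<notin> T\<close> by blast
  moreover have "Disj (Var p) (Var q) \<in> T"
    by (simp add: T_def)
  ultimately show False
    using \<open>Var p \<notin> T\<close> \<open>Var q \<notin> T\<close>
    unfolding admissible_def by (auto simp: DP_rule_def subst_Var dest!: spec[of _ Var])
qed

text \<open>If \<open>B\<close> is not derivable from \<open>A\<close>, the consequences of
  \<open>A\<close> extend to a prime theory without \<open>B\<close>. It validates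
  \<open>\<S>\<close> and \<open>DP_rule\<close>, yet the identity substitution refutes the rule
  from \<open>A\<close> to \<open>B\<close>.\<close>

lemma DP_rule_conservative:
  assumes form: "\<And>s. s \<in> \<S> \<Longrightarrow> \<exists>r. s = rule_disj q r \<and> q \<notin> rule_vars r"
    and der: "derivable_from (insert (DP_rule p q') \<S>) ({|A|}, {|B|})"
  shows "derivable_from \<S> ({|A|}, {|B|})"
proof (rule ccontr)
  assume "\<not> derivable_from \<S> ({|A|}, {|B|})"
  then have "B \<notin> {F. m_derives \<S> {|A|} {|F|}}"
    by (simp add: derivable_from_def)
  moreover have "admissible {F. m_derives \<S> {|A|} {|F|}} s" if "s \<in> \<S>" for s
    using form[OF that] that
    by (intro admissible_m_derives) (auto simp: rule_disj_def single_conclusion_def)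
  ultimately obtain T where T: "{F. m_derives \<S> {|A|} {|F|}} \<subseteq> T" "int_theory T"
    "\<And>s. s \<in> \<S> \<Longrightarrow> admissible T s" "B \<notin> T" "disjunction_property T"
    using prime_extension[OF int_theory_m_derives[of \<S> A] _ _ form] by blast
  have "A \<in> T" "Bot \<notin> T"
    using T m_derives_refl int_theory_BotE by blast+
  have "admissible T s" if "s \<in> insert (DP_rule p q') \<S>" for s
    using that T(3) DP_rule_admissible[OF T(5)] by blast
  then have "admissible T ({|A|}, {|B|})"
    using derivable_from_admissible[OF T(2) \<open>Bot \<notin> T\<close> _ der] by blast
  then show False
    using \<open>A \<in> T\<close> \<open>B \<notin> T\<close> unfolding admissible_single by (metis subst_Var)
qed

section \<open>Splitting disjunctions with \<open>DP_rule\<close>\<close>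

lemma m_derives_DP:
  assumes "DP_rule p q \<in> \<S>" "p \<noteq> q"
  shows "m_derives \<S> {|Disj A B|} {|A, B|}"
  \<comment> \<open>Every variable other than \<open>p\<close> goes to \<open>B\<close>;
    \<open>p \<noteq> q\<close> ensures that \<open>q\<close> is among them.\<close>
  using m_derives_subst[OF m_derives_rule[of "{|Disj (Var p) (Var q)|}" "{|Var p, Var q|}" \<S>],
      of "\<lambda>x. if x = p then A else B"] assms
  by (simp add: DP_rule_def)

lemma m_derives_disj_list:
  assumes "DP_rule p q \<in> \<S>" "p \<noteq> q"
  shows "m_derives \<S> {|disj_list xs|} (fset_of_list xs)"
proof (induction xs rule: disj_list.induct)
  case 1
  \<comment> \<open>The empty disjunction is \<open>Bot\<close>, which \<open>int_sequent\<close>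
    identifies with the empty right-hand side.\<close>
  show ?case
    by (rule m_derives_int) (simp add: int_sequent_def int_derives.Assm)
next
  case (2 A)
  show ?case by (simp add: m_derives_refl)
next
  case (3 A B As)
  let ?D = "disj_list (B # As)"
  \<comment> \<open>The tail \<open>?D\<close> is put first because it is the formula cut against
    the induction hypothesis.\<close>
  have "m_derives \<S> {|Disj A ?D|} (finsert ?D {|A|})"
    using m_derives_DP[OF assms] by (simp add: finsert_commute)
  from m_derives_cut[OF 3 this] show ?case
    by (simp add: finsert_commute)
qed

text \<open>The derivation runs from \<Gamma> to \<open>bigconj \<Gamma>\<close>, on to
  \<open>bigdisj \<Delta>\<close> and finally to \<Delta>. The s-basis gives the middle step and
  \<open>DP_rule\<close> the last one.\<close>

lemma m_basis_DP:
  assumes L: "intermediate_logic L" and "s_basis L \<S>" and "p \<noteq> q"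
  shows "m_basis L (\<S> \<union> {DP_rule p q})"
  unfolding m_basis_def
proof (intro allI impI)
  fix r assume adm: "admissible L r"
  note th = intermediate_logic_int_theory[OF L]
  let ?\<Gamma> = "fst r" and ?\<Delta> = "snd r" and ?S = "\<S> \<union> {DP_rule p q}"
  have "admissible L ({|bigconj ?\<Gamma>|}, {|bigdisj ?\<Delta>|})"
    unfolding admissible_single
  proof (intro allI impI)
    fix \<sigma> assume *: "subst \<sigma> (bigconj ?\<Gamma>) \<in> L"
    then have "subst \<sigma> ` fset ?\<Gamma> \<subseteq> L"
      using int_derives_subst_mem[OF th bigconj_int_derives] by auto
    \<comment> \<open>Which conclusion lands in \<open>L\<close> may depend on \<sigma>; passing to
      the disjunction absorbs this dependence.\<close>
    then obtain B where "B \<in> fset ?\<Delta>" "subst \<sigma> B \<in> L"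
      using adm unfolding admissible_def by blast
    then show "subst \<sigma> (bigdisj ?\<Delta>) \<in> L"
      using int_derives_subst_mem[OF th int_derives_bigdisj] by auto
  qed
  then have "m_derives \<S> {|bigconj ?\<Gamma>|} {|bigdisj ?\<Delta>|}"
    using assms(2) by (auto simp: s_basis_def single_conclusion_def derivable_from_def)
  then have "m_derives ?S {|bigconj ?\<Gamma>|} {|bigdisj ?\<Delta>|}"
    by (rule m_derives_mono[rotated]) blast
  moreover have "m_derives ?S ?\<Gamma> {|bigconj ?\<Gamma>|}"
    by (rule m_derives_int) (simp add: int_sequent_def int_derives_bigconj)
  moreover have "m_derives ?S {|bigdisj ?\<Delta>|} ?\<Delta>"
    using m_derives_disj_list[of p q ?S "enum_of ?\<Delta>"] \<open>p \<noteq> q\<close>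
    by (simp add: bigdisj_def fset_of_list_enum_of)
  ultimately show "derivable_from ?S r"
    unfolding derivable_from_def by (meson m_derives_trans)
qed

theorem mainTheorem10:
  fixes L :: "form set" and \<R> :: "mrule set" and q p q' :: nat
  assumes "intermediate_logic L" and "disjunction_property L"
    and "\<forall>r \<in> \<R>. q \<notin> rule_vars r"
    and "\<forall>r \<in> rule_disj q ` \<R>. admissible L r"
    and "independent (rule_disj q ` \<R>)"
    and "s_basis L (rule_disj q ` \<R>)"
    and "p \<noteq> q'"
  shows "independent (rule_disj q ` \<R> \<union> {DP_rule p q'}) \<and>
         m_basis L (rule_disj q ` \<R> \<union> {DP_rule p q'})"
proof
  let ?Rq = "rule_disj q ` \<R>"
  show "independent (?Rq \<union> {DP_rule p q'})"
    unfolding independent_def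
  proof (intro ballI notI)
    fix s assume s: "s \<in> ?Rq \<union> {DP_rule p q'}"
      and der: "derivable_from (?Rq \<union> {DP_rule p q'} - {s}) s"
    show False
    proof (cases "s \<in> ?Rq")
      case True
      then obtain A B where s_eq: "s = ({|A|}, {|B|})"
        by (auto simp: rule_disj_def)
      have "?Rq \<union> {DP_rule p q'} - {s} \<subseteq> insert (DP_rule p q') (?Rq - {s})"
        by blast
      then have "derivable_from (insert (DP_rule p q') (?Rq - {s})) s"
        using der m_derives_mono unfolding derivable_from_def by blast
      \<comment> \<open>Conservativity is applied to the remaining rules only, so
        \<open>DP_rule\<close> drops out and independence of \<open>?Rq\<close> is
        contradicted.\<close>
      then have "derivable_from (?Rq - {s}) s"
        unfolding s_eq by (rule DP_rule_conservative[rotated]) (use assms(3) in blast)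
      then show False
        using assms(5) True by (auto simp: independent_def)
    next
      case False
      then have "s = DP_rule p q'"
        using s by blast
      \<comment> \<open>With \<open>DP_rule\<close> removed only members of \<open>?Rq\<close> are
        left; that they have one conclusion is part of \<open>s_basis\<close>.\<close>
      moreover have "single_conclusion t \<and> admissible L t"
        if "t \<in> ?Rq \<union> {DP_rule p q'} - {s}" for t
        using that assms(4,6) \<open>s = _\<close> by (auto simp: s_basis_def)
      ultimately show False
        using DP_rule_not_derivable[OF assms(1,7)] der by blast
    qed
  qed
  show "m_basis L (?Rq \<union> {DP_rule p q'})"
    using m_basis_DP assms by blast
qed

end
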